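(* Let $n\ge 4$ be a natural number, let $G:=\mathbb{Z}/2^n\mathbb{Z}$, and let $A\subset G$ be the set $$A:=\{(4m+1)2^j \bmod 2^n : m\in\mathbb{Z},\ 0\le j\le n-2\}.$$ Then $\phi(A)=4$ and $|A|=2^{n-1}-1$, but there do not exist $a_1,a_2\in A$ with $a_1+a_2=0$.
   Context: For subsets $A,B$ of an additive (abelian) group $G$, $B$ is sum-avoiding in $A$ if there do not exist distinct $b_1,b_2\in B$ with $b_1+b_2\in A$. Define $\phi(A):=\sup\{|B| : B\subseteq A,\ B \text{ finite and sum-avoiding in } A\}$. *)

theory Defs
  imports "HOL-Algebra.Elementary_Groups" "HOL-Library.Extended_Nat"
begin

text \<open>
  The ambient abelian group is a HOL-Algebra group in multiplicative notation: its operation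
  plays the role of addition, and its unit that of zero.
\<close>

definition sum_avoiding :: "('a, 'b) monoid_scheme \<Rightarrow> 'a set \<Rightarrow> 'a set \<Rightarrow> bool"
  where "sum_avoiding G B A \<longleftrightarrow>
    \<not> (\<exists>b\<^sub>1\<in>B. \<exists>b\<^sub>2\<in>B. b\<^sub>1 \<noteq> b\<^sub>2 \<and> b\<^sub>1 \<otimes>\<^bsub>G\<^esub> b\<^sub>2 \<in> A)"

text \<open>The supremum is taken in the extended naturals, since it may be infinite for infinite \<open>A\<close>.\<close>

definition sum_avoiding_number :: "('a, 'b) monoid_scheme \<Rightarrow> 'a set \<Rightarrow> enat"
  where "sum_avoiding_number G A =
    (SUP B\<in>{B. B \<subseteq> A \<and> finite B \<and> sum_avoiding G B A}. enat (card B))"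

end

theory Submission
  imports Defs "HOL-Computational_Algebra.Euclidean_Algorithm"
begin

text \<open>
  Lift the set to the integers: \<open>A\<close> consists of the residues of the integers
  \<open>(4 * m + 1) * 2 ^ j\<close> with \<open>j \<le> N\<close>, where \<open>n = N + 2\<close>. Since adding a multiple of
  \<open>2 ^ (N + 2)\<close> changes neither \<open>j\<close> nor the odd part modulo 4, membership in \<open>A\<close> can be tested
  on any integer representative, and everything reduces to integer arithmetic with the exponent
  \<open>j\<close>, the \<^emph>\<open>level\<close>, and the odd part.

  A nonzero integer and its negative have odd parts that are opposite modulo 4, so exactly
  one of the two has odd part 1 modulo 4. Hence no two elements of \<open>A\<close> cancel, and \<open>A\<close>, \<open>-A\<close>
  and the two residues divisible by \<open>2 ^ (n - 1)\<close> partition the group, which gives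
  \<open>2 * card A + 2 = 2 ^ n\<close>.

  For the upper bound \<open>\<phi>(A) \<le> 4\<close>, look at two distinct elements of \<open>A\<close>. If their levels differ
  by at least 2, the sum has the smaller level and its odd part is still 1 modulo 4. If the levels
  agree and the parameters \<open>m\<close> have the same parity, the sum is on the next level, again with odd
  part 1 modulo 4; the next level is still admissible, since the top level contains only one
  residue. In both cases the sum lies in \<open>A\<close>. So on a sum-avoiding set the pair (parity of the
  level, parity of \<open>m\<close>) is injective, and this pair takes only four values. The set
  \<open>{1, 5, 2, 10}\<close> attains the bound, because every sum of two of its distinct elements has odd
  part 3 modulo 4.
\<close>

section \<open>Integers with odd part 1 modulo 4\<close>

definition odd_part_one_mod_four :: "nat \<Rightarrow> int set"
  where "odd_part_one_mod_four N = {(4 * m + 1) * 2 ^ j | m j. j \<le> N}"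

lemma odd_part_one_mod_fourI:
  "x = (4 * m + 1) * 2 ^ j \<Longrightarrow> j \<le> N \<Longrightarrow> x \<in> odd_part_one_mod_four N"
  unfolding odd_part_one_mod_four_def by blast

lemma odd_part_one_mod_fourE:
  assumes "x \<in> odd_part_one_mod_four N"
  obtains m j where "x = (4 * m + 1) * 2 ^ j" "j \<le> N"
  using assms unfolding odd_part_one_mod_four_def by blast

lemma odd_part_unique:
  fixes u v :: int
  assumes "odd u" "odd v" "u * 2 ^ i = v * 2 ^ j"
  shows "u = v"
  using assms(3)
proof (induction i j rule: diff_induct)
  case (1 i)
  then show ?case using assms(2) by (cases i) auto
next
  case (2 j)
  then show ?case using assms(1) by auto
next
  case (3 i j)
  then show ?case by auto
qed

text \<open>
  On level \<open>j \<le> N\<close>, a multiple of \<open>2 ^ (N + 2)\<close> contributes a multiple of 4 to the odd part.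
\<close>

lemma odd_part_one_mod_four_shift:
  assumes "x \<in> odd_part_one_mod_four N"
  shows "x + k * 2 ^ (N + 2) \<in> odd_part_one_mod_four N"
proof -
  obtain m j where x: "x = (4 * m + 1) * 2 ^ j" and j: "j \<le> N"
    using assms by (rule odd_part_one_mod_fourE)
  have "(2::int) ^ (N + 2) = 4 * 2 ^ (N - j) * 2 ^ j"
    using j by (simp flip: power_add)
  then have "x + k * 2 ^ (N + 2) = (4 * (m + k * 2 ^ (N - j)) + 1) * 2 ^ j"
    unfolding x by (simp add: algebra_simps)
  then show ?thesis using j by (rule odd_part_one_mod_fourI)
qed

lemma mod_in_odd_part_one_mod_four_iff:
  "x mod 2 ^ (N + 2) \<in> odd_part_one_mod_four N \<longleftrightarrow> x \<in> odd_part_one_mod_four N"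
  using odd_part_one_mod_four_shift[of "x mod 2 ^ (N + 2)" N "x div 2 ^ (N + 2)"]
    odd_part_one_mod_four_shift[of x N "- (x div 2 ^ (N + 2))"]
  by (auto simp: mod_div_mult_eq minus_div_mult_eq_mod)

lemma residues_odd_part_one_mod_four:
  "{((4 * m + 1) * 2 ^ j) mod 2 ^ (N + 2) | (m :: int) (j :: nat). j \<le> N}
    = odd_part_one_mod_four N \<inter> {0..<2 ^ (N + 2)}" (is "?A = ?R")
proof
  show "?A \<subseteq> ?R"
    using mod_in_odd_part_one_mod_four_iff[of _ N] odd_part_one_mod_fourI[OF refl, of _ N]
    by (auto simp del: power_Suc)
  show "?R \<subseteq> ?A"
  proof
    fix x assume "x \<in> ?R"
    then have x: "x \<in> odd_part_one_mod_four N" "x = x mod 2 ^ (N + 2)" by auto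
    obtain m j where "x = (4 * m + 1) * 2 ^ j" "j \<le> N"
      using x(1) by (rule odd_part_one_mod_fourE)
    then show "x \<in> ?A" using x(2) by blast
  qed
qed

lemma minus_notin_odd_part_one_mod_four:
  assumes "x \<in> odd_part_one_mod_four N"
  shows "- x \<notin> odd_part_one_mod_four N"
proof
  assume "- x \<in> odd_part_one_mod_four N"
  then obtain m j where 1: "- x = (4 * m + 1) * 2 ^ j" by (rule odd_part_one_mod_fourE)
  obtain m' j' where 2: "x = (4 * m' + 1) * 2 ^ j'"
    using assms by (rule odd_part_one_mod_fourE)
  have "- (4 * m + 1) * 2 ^ j = (4 * m' + 1) * 2 ^ j'"
    using 1 2 by (simp only: mult_minus_left)
  then have "- (4 * m + 1) = 4 * m' + 1"
    by (rule odd_part_unique[rotated 2]) auto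
  then show False by presburger
qed

lemma odd_part_one_mod_four_not_dvd:
  assumes "x \<in> odd_part_one_mod_four N"
  shows "\<not> 2 ^ (N + 1) dvd x"
proof
  assume dvd: "2 ^ (N + 1) dvd x"
  obtain m j where x: "x = (4 * m + 1) * 2 ^ j" and j: "j \<le> N"
    using assms by (rule odd_part_one_mod_fourE)
  have "2 ^ Suc j dvd x"
    using dvd j le_imp_power_dvd[of "Suc j" "N + 1" "2::int"] by (auto intro: dvd_trans)
  then show False unfolding x by simp
qed

lemma odd_part_one_mod_four_or_minus:
  assumes "\<not> 2 ^ (N + 1) dvd x"
  shows "x \<in> odd_part_one_mod_four N \<or> - x \<in> odd_part_one_mod_four N"
proof -
  have "x \<noteq> 0" "\<not> 2 dvd (1::int)" using assms by auto
  then obtain u where "x = 2 ^ multiplicity 2 x * u" and u: "odd u"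
    by (rule multiplicity_decompose')
  then obtain j where x: "x = u * 2 ^ j" by (metis mult.commute)
  have j: "j \<le> N"
    using assms unfolding x by (metis Suc_eq_plus1 dvd_mult le_imp_power_dvd not_less_eq_eq)
  have "(\<exists>m. u = 4 * m + 1) \<or> (\<exists>m. - u = 4 * m + 1)" using u by presburger
  then show ?thesis
  proof (elim disjE exE)
    fix m assume "u = 4 * m + 1"
    then show ?thesis using x j odd_part_one_mod_fourI by blast
  next
    fix m assume "- u = 4 * m + 1"
    moreover have "- x = - u * 2 ^ j" using x by simp
    ultimately have "- x \<in> odd_part_one_mod_four N" using j odd_part_one_mod_fourI by metis
    then show ?thesis ..
  qed
qed

section \<open>Counting residues by negation\<close>

text \<open>
  Negation pairs off the residues other than the two multiples of \<open>2 ^ (N + 1)\<close>, and each pair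
  contains exactly one residue whose odd part is 1 modulo 4.
\<close>

lemma card_residues_odd_part_one_mod_four:
  "card (odd_part_one_mod_four N \<inter> {0..<2 ^ (N + 2)}) = 2 ^ (N + 1) - 1"
proof -
  define q :: int where "q = 2 ^ (N + 2)"
  define A where "A = odd_part_one_mod_four N \<inter> {0..<q}"
  define Z :: "int set" where "Z = {0, 2 ^ (N + 1)}"
  let ?neg = "\<lambda>x. q - x"
  \<comment> \<open>\<open>q - x\<close> represents the residue of \<open>- x\<close> within \<open>{0..<q}\<close> for \<open>0 < x < q\<close>.\<close>
  have neg_iff: "q - x \<in> odd_part_one_mod_four N \<longleftrightarrow> - x \<in> odd_part_one_mod_four N" for x
    using odd_part_one_mod_four_shift[of "- x" N 1] odd_part_one_mod_four_shift[of "q - x" N "-1"]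
    by (auto simp: q_def)
  have half: "q = 2 * 2 ^ (N + 1)" by (simp add: q_def)
  have Z_dvd: "x \<in> Z \<longleftrightarrow> 2 ^ (N + 1) dvd x" if "x \<in> {0..<q}" for x
  proof
    assume "2 ^ (N + 1) dvd x"
    then obtain k where k: "x = 2 ^ (N + 1) * k" ..
    then have "0 \<le> k" "k < 2"
      using that by (auto simp: half zero_le_mult_iff)
    then have "k = 0 \<or> k = 1" by linarith
    then show "x \<in> Z" unfolding k Z_def by auto
  qed (auto simp: Z_def)
  have "0 \<notin> A" using odd_part_one_mod_four_not_dvd[of 0 N] by (auto simp: A_def)
  then have neg_range: "?neg ` A \<subseteq> {0..<q}" unfolding A_def by (auto simp: less_le)
  have fin: "finite A" "finite Z" by (auto simp: A_def Z_def)
  have disj: "A \<inter> ?neg ` A = {}"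
    using minus_notin_odd_part_one_mod_four[of _ N] neg_iff by (auto simp: A_def)
  have Z_not: "x \<notin> odd_part_one_mod_four N \<and> - x \<notin> odd_part_one_mod_four N" if "x \<in> Z" for x
    using that odd_part_one_mod_four_not_dvd[of _ N] by (fastforce simp: Z_def)
  have disjZ: "(A \<union> ?neg ` A) \<inter> Z = {}"
  proof -
    have "x \<notin> Z" if "x \<in> A" for x using that Z_not by (auto simp: A_def)
    moreover have "q - x \<notin> Z" if "x \<in> A" for x
      using that Z_not[of "q - x"] neg_iff[of "q - x"]
      using odd_part_one_mod_four_shift[of x N "-1"] by (auto simp: A_def q_def)
    ultimately show ?thesis by blast
  qed
  have cover: "{0..<q} = (A \<union> ?neg ` A) \<union> Z"
  proof
    show "{0..<q} \<subseteq> (A \<union> ?neg ` A) \<union> Z"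
    proof
      fix x assume x: "x \<in> {0..<q}"
      show "x \<in> (A \<union> ?neg ` A) \<union> Z"
      proof (cases "x \<in> Z")
        case False
        then have "x \<noteq> 0" by (auto simp: Z_def)
        then have "q - x \<in> {0..<q}" using x by auto
        moreover have "x \<in> odd_part_one_mod_four N \<or> q - x \<in> odd_part_one_mod_four N"
          using False Z_dvd[OF x] odd_part_one_mod_four_or_minus neg_iff by blast
        moreover have "x = ?neg (q - x)" by simp
        ultimately show ?thesis using x unfolding A_def by blast
      qed simp
    qed
    show "(A \<union> ?neg ` A) \<union> Z \<subseteq> {0..<q}"
      using neg_range by (auto simp: A_def Z_def half)
  qed
  have "nat q = card (A \<union> ?neg ` A) + card Z"
    using card_Un_disjoint[of "A \<union> ?neg ` A" Z] fin disjZ unfolding cover[symmetric] by simp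
  also have "card (A \<union> ?neg ` A) = 2 * card A"
    using card_Un_disjoint[of A "?neg ` A"] fin disj by (simp add: card_image)
  also have "card Z = 2" by (simp add: Z_def)
  finally have "2 * 2 ^ (N + 1) = 2 * card A + 2" by (simp add: q_def nat_power_eq nat_mult_distrib)
  then show ?thesis by (simp add: A_def q_def)
qed

section \<open>Sum-avoiding sets\<close>

lemma add_distant_levels:
  assumes "i + 2 \<le> j" "i \<le> N"
  shows "(4 * m + 1) * 2 ^ i + (4 * k + 1) * 2 ^ j \<in> odd_part_one_mod_four N"
proof (rule odd_part_one_mod_fourI)
  define d where "d = j - (i + 2)"
  then have "j = i + 2 + d" using assms(1) by simp
  then show "(4 * m + 1) * 2 ^ i + (4 * k + 1) * 2 ^ j
      = (4 * (m + (4 * k + 1) * 2 ^ d) + 1) * 2 ^ i"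
    by (simp add: algebra_simps power_add)
qed fact

lemma add_same_level:
  assumes "even (m + k)" "j < N"
  shows "(4 * m + 1) * 2 ^ j + (4 * k + 1) * 2 ^ j \<in> odd_part_one_mod_four N"
proof (rule odd_part_one_mod_fourI)
  define d where "d = (m + k) div 2"
  then have "k = 2 * d - m" using assms(1) by simp
  then show "(4 * m + 1) * 2 ^ j + (4 * k + 1) * 2 ^ j = (4 * d + 1) * 2 ^ Suc j"
    by (simp add: left_diff_distrib distrib_right)
qed (use assms(2) in simp)

text \<open>
  The parities of level and parameter determine an element of \<open>B\<close>: levels of equal parity are
  equal or at least 2 apart, so one of the two addition lemmas applies to any two distinct elements
  with the same parities. Sums on the top level \<open>N\<close> leave the set, but a single residue lives
  there.
\<close>

lemma card_pairwise_sum_notin_le_4: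
  assumes B: "B \<subseteq> odd_part_one_mod_four N \<inter> {0..<2 ^ (N + 2)}"
    and avoid: "\<And>x y. x \<in> B \<Longrightarrow> y \<in> B \<Longrightarrow> x \<noteq> y \<Longrightarrow> x + y \<notin> odd_part_one_mod_four N"
  shows "card B \<le> 4"
proof -
  have "\<forall>b\<in>B. \<exists>m j. b = (4 * m + 1) * 2 ^ j \<and> j \<le> N"
    using B unfolding odd_part_one_mod_four_def by blast
  then obtain m j where mj: "\<And>b. b \<in> B \<Longrightarrow> b = (4 * m b + 1) * 2 ^ j b \<and> j b \<le> N"
    by metis
  define code where "code b = (even (j b), even (m b))" for b
  have "inj_on code B"
  proof (rule inj_onI, rule ccontr)
    fix x y assume x: "x \<in> B" and y: "y \<in> B" and "code x = code y" and ne: "x \<noteq> y"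
    then have par: "even (j x) = even (j y)" "even (m x + m y)" by (auto simp: code_def)
    note sum = avoid[OF x y ne] and eqx = mj[OF x] and eqy = mj[OF y]
    have "j x = j y \<or> j x + 2 \<le> j y \<or> j y + 2 \<le> j x"
      using par(1) by presburger
    then consider "j x = j y" | "j x + 2 \<le> j y" | "j y + 2 \<le> j x"
      by blast
    then show False
    proof cases
      case 1
      have "j x = N"
        using sum eqx eqy 1 add_same_level[OF par(2), of "j x" N] by (metis le_neq_implies_less)
      have "b = 2 ^ N" if b: "b \<in> B" "j b = N" for b
      proof -
        have eq: "b = (4 * m b + 1) * 2 ^ N" using mj[OF b(1)] b(2) by simp
        have "0 \<le> b" "b < 4 * 2 ^ N" using B b(1) by auto
        then have "0 \<le> 4 * m b + 1" "4 * m b + 1 < 4"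
          using eq by (metis zero_le_mult_iff zero_less_power zero_less_numeral not_le,
            metis mult_less_cancel_right_pos zero_less_power zero_less_numeral)
        then have "m b = 0" by linarith
        then show ?thesis using eq by simp
      qed
      then show False using x y ne \<open>j x = N\<close> 1 by metis
    next
      case 2
      then show False using sum eqx eqy add_distant_levels by metis
    next
      case 3
      then show False using sum eqx eqy add_distant_levels by (metis add.commute)
    qed
  qed
  then have "card B \<le> card (UNIV :: (bool \<times> bool) set)"
    by (rule card_inj_on_le) auto
  then show ?thesis by (simp add: card_UNIV_bool flip: UNIV_Times_UNIV)
qed

text \<open>
  The six sums are 3, 7, 11, 15, 6 and 12. Their negatives have odd part 1 modulo 4, on levels
  at most 2, so \<open>2 \<le> N\<close> puts the negatives into the set and thereby the sums outside.
\<close>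

lemma sum_notin_witness:
  assumes "2 \<le> N" "x \<in> {1, 5, 2, 10}" "y \<in> {1, 5, 2, 10}" "x \<noteq> y"
  shows "x + y \<notin> odd_part_one_mod_four N"
proof -
  have "-3 \<in> odd_part_one_mod_four N" "-7 \<in> odd_part_one_mod_four N"
    "-11 \<in> odd_part_one_mod_four N" "-15 \<in> odd_part_one_mod_four N"
    "-6 \<in> odd_part_one_mod_four N" "-12 \<in> odd_part_one_mod_four N"
    using odd_part_one_mod_fourI[of "-3" "-1" 0 N] odd_part_one_mod_fourI[of "-7" "-2" 0 N]
      odd_part_one_mod_fourI[of "-11" "-3" 0 N] odd_part_one_mod_fourI[of "-15" "-4" 0 N]
      odd_part_one_mod_fourI[of "-6" "-1" 1 N] odd_part_one_mod_fourI[of "-12" "-1" 2 N] assms(1)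
    by simp_all
  then have "- (x + y) \<in> odd_part_one_mod_four N"
    using assms(2-4) by auto
  then show ?thesis using minus_notin_odd_part_one_mod_four by fastforce
qed

lemma witness_subset:
  assumes "2 \<le> N"
  shows "{1, 5, 2, 10} \<subseteq> odd_part_one_mod_four N \<inter> {0..<2 ^ (N + 2)}"
proof -
  have "(2::int) ^ 4 \<le> 2 ^ (N + 2)" using assms by (intro power_increasing) auto
  moreover have "1 \<in> odd_part_one_mod_four N" "5 \<in> odd_part_one_mod_four N"
    "2 \<in> odd_part_one_mod_four N" "10 \<in> odd_part_one_mod_four N"
    using odd_part_one_mod_fourI[of 1 0 0 N] odd_part_one_mod_fourI[of 5 1 0 N]
      odd_part_one_mod_fourI[of 2 0 1 N] odd_part_one_mod_fourI[of 10 1 1 N] assms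
    by simp_all
  ultimately show ?thesis by auto
qed

theorem proposition1p3:
  fixes n :: nat and G :: "int monoid" and A :: "int set"
  assumes "n \<ge> 4"
    and "G = integer_mod_group (2 ^ n)"
    and "A = {((4 * m + 1) * 2 ^ j) mod 2 ^ n | (m :: int) (j :: nat). j \<le> n - 2}"
  shows "sum_avoiding_number G A = 4 \<and> card A = 2 ^ (n - 1) - 1 \<and>
    \<not> (\<exists>a\<^sub>1\<in>A. \<exists>a\<^sub>2\<in>A. a\<^sub>1 \<otimes>\<^bsub>G\<^esub> a\<^sub>2 = \<one>\<^bsub>G\<^esub>)"
proof -
  define N where "N = n - 2"
  have n: "n = N + 2" and N: "2 \<le> N" using assms(1) by (auto simp: N_def)
  let ?S = "odd_part_one_mod_four N"
  have A: "A = ?S \<inter> {0..<2 ^ (N + 2)}"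
    using residues_odd_part_one_mod_four[of N] unfolding assms(3) n by simp
  have mult: "x \<otimes>\<^bsub>G\<^esub> y = (x + y) mod 2 ^ (N + 2)" for x y
    unfolding assms(2) n by (simp add: mult_integer_mod_group)
  have mult_in_A: "x \<otimes>\<^bsub>G\<^esub> y \<in> A \<longleftrightarrow> x + y \<in> ?S" for x y
    unfolding mult A using mod_in_odd_part_one_mod_four_iff[of "x + y" N] by simp
  have avoiding: "sum_avoiding G B A \<longleftrightarrow> (\<forall>x\<in>B. \<forall>y\<in>B. x \<noteq> y \<longrightarrow> x + y \<notin> ?S)" for B
    unfolding sum_avoiding_def mult_in_A by blast
  have "sum_avoiding_number G A = 4"
  proof (rule antisym)
    show "sum_avoiding_number G A \<le> 4"
      unfolding sum_avoiding_number_def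
    proof (rule SUP_least)
      fix B assume "B \<in> {B. B \<subseteq> A \<and> finite B \<and> sum_avoiding G B A}"
      then have "B \<subseteq> A" "sum_avoiding G B A" by auto
      then have "B \<subseteq> ?S \<inter> {0..<2 ^ (N + 2)}" "\<forall>x\<in>B. \<forall>y\<in>B. x \<noteq> y \<longrightarrow> x + y \<notin> ?S"
        using A avoiding[of B] by simp_all
      then have "card B \<le> 4"
        by (intro card_pairwise_sum_notin_le_4[of B N]) blast+
      then show "enat (card B) \<le> 4" by (simp add: numeral_eq_enat)
    qed
    have "{1, 5, 2, 10} \<in> {B. B \<subseteq> A \<and> finite B \<and> sum_avoiding G B A}"
    proof (intro CollectI conjI)
      show "{1, 5, 2, 10} \<subseteq> A" unfolding A by (rule witness_subset[OF N])
      show "sum_avoiding G {1, 5, 2, 10} A"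
        unfolding avoiding by (intro ballI impI) (rule sum_notin_witness[OF N])
    qed simp
    then have "enat (card {1, 5, 2, 10 :: int}) \<le> sum_avoiding_number G A"
      unfolding sum_avoiding_number_def by (rule SUP_upper)
    moreover have "card {1, 5, 2, 10 :: int} = 4" by simp
    ultimately show "4 \<le> sum_avoiding_number G A" by (simp only: numeral_eq_enat)
  qed
  moreover have "card A = 2 ^ (n - 1) - 1"
    using card_residues_odd_part_one_mod_four[of N] by (simp add: A n)
  moreover have "\<not> (\<exists>a\<^sub>1\<in>A. \<exists>a\<^sub>2\<in>A. a\<^sub>1 \<otimes>\<^bsub>G\<^esub> a\<^sub>2 = \<one>\<^bsub>G\<^esub>)"
  proof safe
    fix x y assume x: "x \<in> A" and y: "y \<in> A" and "x \<otimes>\<^bsub>G\<^esub> y = \<one>\<^bsub>G\<^esub>"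
    then have "(x + y) mod 2 ^ (N + 2) = 0" unfolding mult unfolding assms(2) n by simp
    then obtain k where "x + y = 2 ^ (N + 2) * k" by (auto elim!: dvdE)
    then have "- x = y + (- k) * 2 ^ (N + 2)" by (simp add: algebra_simps)
    then have "- x \<in> ?S" using odd_part_one_mod_four_shift[of y N "- k"] y by (simp add: A)
    then show False using minus_notin_odd_part_one_mod_four[of x N] x by (simp add: A)
  qed
  ultimately show ?thesis by blast
qed

end
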